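(* Let $\mathcal{A}\in\mathbb{R}^{[m,n]}$ be a $Z$-tensor and $b\in\mathbb{R}^n$ with $b\ge 0$. Suppose that $$\mathcal{S}_g=\{x\in\mathbb{R}^n \mid x\ge 0,\ \mathcal{A}x^{m-1}\ge b\}\neq\emptyset.$$ Let $\mathcal{A}=\mathcal{M}-\mathcal{N}$ be the level-1 splitting of $\mathcal{A}$, let $M$ be the majorization matrix of $\mathcal{A}$, and let $M=P-Q$ where $P$ is a nonsingular $M$-matrix and $Q\ge 0$. Then for $x_0=0$, the sequence $\{x_k\}$ of nonnegative vectors given by the iteration $$P x_{k+1}^{[m-1]}=Q x_k^{[m-1]}+\mathcal{N}x_k^{m-1}+b,\qquad k\ge 0,$$ is monotonically increasing (i.e. $x_k\le x_{k+1}$ for all $k$) and converges to the minimal nonnegative solution of $\mathcal{A}x^{m-1}=b$.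
   Context: $\mathbb{R}^{[m,n]}$ ($m\ge 2$, $n\ge 1$) is the set of real $m$th-order $n$-dimensional tensors $\mathcal{A}=(a_{i_1i_2\ldots i_m})$, $1\le i_1,\ldots,i_m\le n$. For $x\in\mathbb{R}^n$, $\mathcal{A}x^{m-1}\in\mathbb{R}^n$ has entries $(\mathcal{A}x^{m-1})_i=\sum_{i_2,\ldots,i_m=1}^n a_{ii_2\ldots i_m}x_{i_2}\cdots x_{i_m}$. Diagonal elements are $a_{ii\ldots i}$; all others are off-diagonal. $\mathcal{A}$ is a $Z$-tensor if all its off-diagonal elements are nonpositive. Vector inequalities $x\ge y$ and $x>y$, and inequalities for matrices and tensors, are entrywise. For $r>0$ and $x\ge 0$, $x^{[r]}$ is the entrywise power, $(x^{[r]})_i=(x_i)^r$. A minimal nonnegative solution of $\mathcal{A}x^{m-1}=b$ is a solution $x$ with $0\le x\le y$ for every solution $y\ge 0$. Level-1 splitting: $\mathcal{A}=\mathcal{M}-\mathcal{N}$, where $\mathcal{M}=(m_{i_1\ldots i_m})$ has $m_{ij\ldots j}=a_{ij\ldots j}$ for all $i,j\in\{1,\ldots,n\}$ and all other elements zero. The majorization matrix of $\mathcal{A}$ is the $n\times n$ matrix $M$ with $(i,j)$ entry $a_{ij\ldots j}$, so $\mathcal{M}x^{m-1}=Mx^{[m-1]}$. A nonsingular $M$-matrix is a matrix of the form $sI-B$ with $B\ge 0$ and $s>\rho(B)$. Explicitly, the iteration is $x_{k+1}=\left(P^{-1}(Qx_k^{[m-1]}+\mathcal{N}x_k^{m-1}+b)\right)^{[1/(m-1)]}$.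 *)

theory Defs
  imports "HOL-Analysis.Analysis"
begin

text \<open>
  A real tensor of order \<open>m\<close> and dimension \<open>CARD('n)\<close> is a function on index lists; only its
  values on lists of length \<open>m\<close> are meaningful, and every definition below that takes a tensor
  depends on those values only (for \<open>m \<ge> 1\<close>).
\<close>

type_synonym 'n tensor = "'n list \<Rightarrow> real"

definition tensor_app :: "nat \<Rightarrow> 'n::finite tensor \<Rightarrow> real ^ 'n \<Rightarrow> real ^ 'n" where
  "tensor_app m A x =
     (\<chi> i. \<Sum>js | length js = m - 1. A (i # js) * prod_list (map (\<lambda>j. x $ j) js))"

definition Z_tensor :: "nat \<Rightarrow> 'n tensor \<Rightarrow> bool" where
  "Z_tensor m A \<longleftrightarrow>
     (\<forall>is. length is = m \<and> (\<nexists>i. is = replicate m i) \<longrightarrow> A is \<le> 0)"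

text \<open>The splitting \<open>A = MM - NN\<close> where \<open>MM\<close> keeps exactly the entries of \<open>A\<close> with index
  \<open>(i, j, \<dots>, j)\<close>.\<close>

definition level1_splitting :: "nat \<Rightarrow> 'n tensor \<Rightarrow> 'n tensor \<Rightarrow> 'n tensor \<Rightarrow> bool" where
  "level1_splitting m A MM NN \<longleftrightarrow>
     (\<forall>i js. length js = m - 1 \<longrightarrow>
        MM (i # js) = (if \<exists>j. js = replicate (m - 1) j then A (i # js) else 0)) \<and>
     (\<forall>is. length is = m \<longrightarrow> A is = MM is - NN is)"

definition majorization_matrix :: "nat \<Rightarrow> 'n::finite tensor \<Rightarrow> real ^ 'n ^ 'n" where
  "majorization_matrix m A = (\<chi> i j. A (i # replicate (m - 1) j))"

text \<open>Entrywise power; only natural exponents are needed.\<close>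

definition vec_power :: "real ^ 'n \<Rightarrow> nat \<Rightarrow> real ^ 'n" where
  "vec_power x r = (\<chi> i. (x $ i) ^ r)"

text \<open>The eigenvalues of a real matrix are the complex ones.\<close>

definition eigenvalues :: "real ^ 'n ^ 'n \<Rightarrow> complex set" where
  "eigenvalues B =
     {z. \<exists>v :: complex ^ 'n. v \<noteq> 0 \<and> map_matrix complex_of_real B *v v = z *s v}"

definition spectral_radius :: "real ^ 'n ^ 'n \<Rightarrow> real" where
  "spectral_radius B = (SUP z\<in>eigenvalues B. cmod z)"

text \<open>The orders on vectors and matrices are entrywise; \<open>mat s\<close> is \<open>s\<close> times the identity.\<close>

definition nonsingular_M_matrix :: "real ^ 'n ^ 'n \<Rightarrow> bool" where
  "nonsingular_M_matrix P \<longleftrightarrow> (\<exists>s B. 0 \<le> B \<and> spectral_radius B < s \<and> P = mat s - B)"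

definition minimal_nonneg_solution ::
    "nat \<Rightarrow> 'n::finite tensor \<Rightarrow> real ^ 'n \<Rightarrow> real ^ 'n \<Rightarrow> bool" where
  "minimal_nonneg_solution m A b x \<longleftrightarrow>
     0 \<le> x \<and> tensor_app m A x = b \<and> (\<forall>y. 0 \<le> y \<and> tensor_app m A y = b \<longrightarrow> x \<le> y)"

definition splitting_iteration ::
    "nat \<Rightarrow> real ^ 'n ^ 'n \<Rightarrow> real ^ 'n ^ 'n \<Rightarrow> 'n::finite tensor \<Rightarrow> real ^ 'n
       \<Rightarrow> (nat \<Rightarrow> real ^ 'n) \<Rightarrow> bool" where
  "splitting_iteration m P Q NN b x \<longleftrightarrow>
     x 0 = 0 \<and> (\<forall>k. 0 \<le> x k) \<and>
     (\<forall>k. P *v vec_power (x (Suc k)) (m - 1)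
            = Q *v vec_power (x k) (m - 1) + tensor_app m NN (x k) + b)"

end

theory Submission
  imports Defs
begin

text \<open>
  The only spectral input is that \<open>P\<close> is inverse monotone. For \<open>P = sI - B\<close> follow the solution
  \<open>u(t)\<close> of \<open>(tI - B) u = 1\<close> from large \<open>t\<close>, where it is positive, down to \<open>t = s\<close>: it is
  continuous because no \<open>t \<ge> s\<close> is an eigenvalue of \<open>B\<close>, and it cannot touch the boundary of the
  nonnegative orthant, since a vanishing entry would give \<open>1 = -(B u)\<^sub>i \<le> 0\<close>. So \<open>P u > 0\<close> for some
  \<open>u > 0\<close>, and comparison with multiples of \<open>u\<close> shows that \<open>P v \<ge> 0\<close> implies \<open>v \<ge> 0\<close>.
  Inverse monotonicity turns the recursion into a monotone map bounded by every element of
  the feasible set; the limit of the increasing iterates lies below every such element, hence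
  below every nonnegative solution.
\<close>

section \<open>Inverse monotone matrices\<close>

lemma mat_minus_mult_component:
  fixes B :: "real ^ 'n ^ 'n"
  shows "((mat t - B) *v v) $ i = t * v $ i - (\<Sum>j\<in>UNIV. B $ i $ j * v $ j)"
proof -
  have "(mat t *v v) $ i = t * v $ i"
    by (simp add: matrix_vector_mult_def mat_def mult_delta_left)
  then show ?thesis
    by (simp add: matrix_vector_mult_diff_rdistrib) (simp add: matrix_vector_mult_def)
qed

lemma matrix_vector_mult_mono:
  fixes Q :: "real ^ 'n ^ 'm"
  assumes "0 \<le> Q" and "x \<le> y"
  shows "Q *v x \<le> Q *v y"
  using assms by (auto simp: less_eq_vec_def matrix_vector_mult_def intro!: sum_mono mult_left_mono)

text \<open>If \<open>v\<close> had a negative entry, the minimum \<open>c\<close> of the ratios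
  \<open>v $ i / u $ i\<close> would be negative. Then \<open>w = v - c *\<^sub>R u\<close> is
  nonnegative and vanishes at a minimizing index \<open>k\<close>, so row \<open>k\<close> of
  \<open>(mat t - B) *v w\<close> is at most 0; but that row is a nonnegative number minus
  \<open>c\<close> times a positive one.\<close>

lemma inverse_monotone_if_semipositive:
  fixes B :: "real ^ 'n ^ 'n"
  assumes B: "0 \<le> B" and u: "\<And>i. 0 < u $ i" and Pu: "\<And>i. 0 < ((mat t - B) *v u) $ i"
    and Pv: "0 \<le> (mat t - B) *v v"
  shows "0 \<le> v"
proof (rule ccontr)
  assume "\<not> 0 \<le> v"
  then obtain i0 where i0: "v $ i0 < 0"
    by (auto simp: less_eq_vec_def not_le)
  define c where "c = Min (range (\<lambda>i. v $ i / u $ i))"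
  have c_le: "c \<le> v $ i / u $ i" for i
    unfolding c_def by (rule Min_le) auto
  have "c \<in> range (\<lambda>i. v $ i / u $ i)"
    unfolding c_def by (rule Min_in) auto
  then obtain k where k: "c = v $ k / u $ k"
    by auto
  have "c < 0"
    using c_le[of i0] divide_neg_pos[OF i0 u[of i0]] by linarith
  define w where "w = v - c *\<^sub>R u"
  have w_nonneg: "0 \<le> w $ i" for i
    using c_le[of i] u[of i] by (simp add: w_def field_simps)
  have "w $ k = 0"
    using k u[of k] by (simp add: w_def)
  moreover have "0 \<le> (\<Sum>j\<in>UNIV. B $ k $ j * w $ j)"
    using B w_nonneg by (auto simp: less_eq_vec_def intro!: sum_nonneg)
  ultimately have "((mat t - B) *v w) $ k \<le> 0"
    unfolding mat_minus_mult_component by simp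
  moreover have "((mat t - B) *v w) $ k = ((mat t - B) *v v) $ k - c * ((mat t - B) *v u) $ k"
    by (simp add: w_def matrix_vector_mult_diff_distrib matrix_vector_mult_scaleR)
  moreover have "0 \<le> ((mat t - B) *v v) $ k"
    using Pv by (simp add: less_eq_vec_def)
  moreover have "c * ((mat t - B) *v u) $ k < 0"
    using \<open>c < 0\<close> Pu[of k] by (rule mult_neg_pos)
  ultimately show False
    by linarith
qed

section \<open>Eigenvalue bounds and nonsingularity above the spectral radius\<close>

lemma cmod_eigenvalue_le_sum_entries:
  fixes B :: "real ^ 'n ^ 'n"
  assumes "z \<in> eigenvalues B"
  shows "cmod z \<le> (\<Sum>i\<in>UNIV. \<Sum>j\<in>UNIV. \<bar>B $ i $ j\<bar>)"
proof -
  obtain v :: "complex ^ 'n" where v: "v \<noteq> 0" "map_matrix complex_of_real B *v v = z *s v"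
    using assms by (auto simp: eigenvalues_def)
  \<comment> \<open>Reading the eigenvector equation in a row \<open>k\<close> where the modulus of
    \<open>v\<close> is maximal bounds \<open>cmod z\<close> by the absolute row sum.\<close>
  define c where "c = Max (range (\<lambda>i. cmod (v $ i)))"
  have le_c: "cmod (v $ i) \<le> c" for i
    unfolding c_def by (rule Max_ge) auto
  have "c \<in> range (\<lambda>i. cmod (v $ i))"
    unfolding c_def by (rule Max_in) auto
  then obtain k where k: "c = cmod (v $ k)"
    by auto
  have "c > 0"
  proof -
    obtain i where "v $ i \<noteq> 0"
      using v(1) by (auto simp: vec_eq_iff)
    then show ?thesis
      using le_c[of i] by (smt (verit) zero_less_norm_iff)
  qed
  have "z * v $ k = (\<Sum>j\<in>UNIV. complex_of_real (B $ k $ j) * v $ j)"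
    using arg_cong[OF v(2), of "\<lambda>x. x $ k"]
    by (simp add: matrix_vector_mult_def map_matrix_def)
  then have "cmod z * c = cmod (\<Sum>j\<in>UNIV. complex_of_real (B $ k $ j) * v $ j)"
    unfolding k by (metis norm_mult)
  also have "\<dots> \<le> (\<Sum>j\<in>UNIV. \<bar>B $ k $ j\<bar> * c)"
    by (rule sum_norm_le) (auto simp: norm_mult intro!: mult_left_mono le_c)
  also have "\<dots> = (\<Sum>j\<in>UNIV. \<bar>B $ k $ j\<bar>) * c"
    by (simp add: sum_distrib_right)
  finally have "cmod z \<le> (\<Sum>j\<in>UNIV. \<bar>B $ k $ j\<bar>)"
    using \<open>c > 0\<close> by simp
  also have "\<dots> \<le> (\<Sum>i\<in>UNIV. \<Sum>j\<in>UNIV. \<bar>B $ i $ j\<bar>)"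
    by (rule member_le_sum[where f = "\<lambda>i. \<Sum>j\<in>UNIV. \<bar>B $ i $ j\<bar>"]) (auto intro: sum_nonneg)
  finally show ?thesis .
qed

text \<open>The supremum of a real set is an upper bound only if the set is bounded, which the crude
  entry-sum bound supplies.\<close>

lemma cmod_eigenvalue_le_spectral_radius:
  assumes "z \<in> eigenvalues B"
  shows "cmod z \<le> spectral_radius B"
  unfolding spectral_radius_def
proof (rule cSUP_upper[OF assms])
  show "bdd_above (cmod ` eigenvalues B)"
    by (rule bdd_aboveI2) (rule cmod_eigenvalue_le_sum_entries)
qed

text \<open>A nonzero real kernel vector, read over the complex numbers, would be an eigenvector of
  \<open>B\<close> for \<open>t\<close>.\<close>

lemma mat_minus_kernel_trivial:
  fixes B :: "real ^ 'n ^ 'n"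
  assumes "spectral_radius B < t" and v: "(mat t - B) *v v = 0"
  shows "v = 0"
proof (rule ccontr)
  assume "v \<noteq> 0"
  define w where "w = (\<chi> i. complex_of_real (v $ i))"
  have "w \<noteq> 0"
    using \<open>v \<noteq> 0\<close> by (simp add: w_def vec_eq_iff)
  moreover have "map_matrix complex_of_real B *v w = complex_of_real t *s w"
    unfolding vec_eq_iff
  proof
    fix i
    have "(\<Sum>j\<in>UNIV. B $ i $ j * v $ j) = t * v $ i"
      using mat_minus_mult_component[of t B v i] v by simp
    then have "complex_of_real (\<Sum>j\<in>UNIV. B $ i $ j * v $ j) = complex_of_real (t * v $ i)"
      by (rule arg_cong)
    then show "(map_matrix complex_of_real B *v w) $ i = (complex_of_real t *s w) $ i"
      by (simp add: matrix_vector_mult_def map_matrix_def w_def)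
  qed
  ultimately have "complex_of_real t \<in> eigenvalues B"
    by (auto simp: eigenvalues_def)
  then have "\<bar>t\<bar> \<le> spectral_radius B"
    using cmod_eigenvalue_le_spectral_radius by fastforce
  then show False
    using assms(1) by linarith
qed

lemma det_mat_minus_nonzero:
  fixes B :: "real ^ 'n ^ 'n"
  assumes "spectral_radius B < t"
  shows "det (mat t - B) \<noteq> 0"
proof -
  have "\<forall>x. (mat t - B) *v x = 0 \<longrightarrow> x = 0"
    using mat_minus_kernel_trivial[OF assms] by blast
  then have "invertible (mat t - B)"
    using matrix_left_invertible_ker invertible_left_inverse by blast
  then show ?thesis
    by (simp add: invertible_det_nz)
qed

section \<open>Continuation in \<open>t\<close> down to \<open>s\<close>\<close>

lemma continuous_on_det:
  fixes F :: "'a::topological_space \<Rightarrow> real ^ 'n ^ 'n"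
  assumes "\<And>i j. continuous_on S (\<lambda>t. F t $ i $ j)"
  shows "continuous_on S (\<lambda>t. det (F t))"
  unfolding det_def by (intro continuous_intros assms)

lemma M_matrix_semipositive:
  fixes B :: "real ^ 'n ^ 'n"
  assumes B: "0 \<le> B" and s: "spectral_radius B < s"
  shows "\<exists>u. (\<forall>i. 0 < u $ i) \<and> (mat s - B) *v u = 1"
proof -
  \<comment> \<open>Cramer's rule: every entry is a quotient of determinants, so continuity in
    \<open>t\<close> can be read off wherever the denominator is nonzero, in particular for
    \<open>t\<close> \<ge> \<open>s\<close>.\<close>
  define u where "u t = (\<chi> k. det (\<chi> i j. if j = k then (1 :: real ^ 'n) $ i else (mat t - B) $ i $ j)
    / det (mat t - B))" for t
  have u_sol: "(mat t - B) *v u t = 1" if "s \<le> t" for t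
  proof -
    have "det (mat t - B) \<noteq> 0"
      using det_mat_minus_nonzero s that by (metis less_le_trans)
    from cramer[OF this, of "u t" 1] show ?thesis
      by (simp add: u_def)
  qed
  have entry_cont: "continuous_on {s..} (\<lambda>t. (mat t - B) $ i $ j)" for i j
    by (cases "i = j") (auto simp: mat_def intro!: continuous_intros)
  have u_cont: "continuous_on {s..} (\<lambda>t. u t $ k)" for k
  proof -
    have "continuous_on {s..} (\<lambda>t. det (\<chi> i j. if j = k then (1 :: real ^ 'n) $ i else (mat t - B) $ i $ j))"
    proof (rule continuous_on_det)
      fix i j
      show "continuous_on {s..} (\<lambda>t. (\<chi> i j. if j = k then (1 :: real ^ 'n) $ i
          else (mat t - B) $ i $ j) $ i $ j)"
        by (cases "j = k") (use entry_cont[of i j] in auto)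
    qed
    moreover have "continuous_on {s..} (\<lambda>t. det (mat t - B))"
      by (rule continuous_on_det) (rule entry_cont)
    moreover have "\<forall>t\<in>{s..}. det (mat t - B) \<noteq> 0"
      using det_mat_minus_nonzero s by (metis atLeast_iff less_le_trans)
    ultimately show ?thesis
      unfolding u_def by (simp add: continuous_on_divide)
  qed
  have u_pos: "0 < u t $ i" if t: "s \<le> t" and nonneg: "\<And>j. 0 \<le> u t $ j" for t i
  proof (rule ccontr)
    assume "\<not> 0 < u t $ i"
    then have "u t $ i = 0"
      using nonneg[of i] by linarith
    moreover have "0 \<le> (\<Sum>j\<in>UNIV. B $ i $ j * u t $ j)"
      using B nonneg by (auto simp: less_eq_vec_def intro!: sum_nonneg)
    ultimately have "((mat t - B) *v u t) $ i \<le> 0"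
      unfolding mat_minus_mult_component by simp
    then show False
      by (simp add: u_sol[OF t])
  qed
  \<comment> \<open>By \<open>u_pos\<close>, nonnegativity of all entries forces strict positivity.
    Hence \<open>T\<close> is cut out both by closed and by finitely many open conditions, so it is
    clopen in the connected ray \<open>{s..}\<close>.\<close>
  define T where "T = {t \<in> {s..}. \<forall>i. 0 \<le> u t $ i}"
  have T_eq: "T = {s..} \<inter> (\<Inter>i. {s..} \<inter> (\<lambda>t. u t $ i) -` {0..})"
    by (auto simp: T_def)
  have T_eq': "T = {s..} \<inter> (\<Inter>i. {s..} \<inter> (\<lambda>t. u t $ i) -` {0<..})"
    using u_pos by (auto simp: T_def intro: less_imp_le)
  have "closedin (top_of_set {s..}) T"
    unfolding T_eq
    by (intro closedin_Int closedin_INT continuous_closedin_preimage u_cont) auto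
  moreover have "openin (top_of_set {s..}) T"
    unfolding T_eq'
    by (intro openin_Int openin_INT2 continuous_openin_preimage_gen u_cont) auto
  moreover have "T \<noteq> {}"
  proof -
    \<comment> \<open>This \<open>t\<close> is at least \<open>s\<close> and exceeds every row sum
      of \<open>B\<close>, so the all-ones vector is a witness of semipositivity.\<close>
    define t where "t = \<bar>s\<bar> + 1 + (\<Sum>i\<in>UNIV. \<Sum>j\<in>UNIV. B $ i $ j)"
    have B_nonneg: "0 \<le> B $ i $ j" for i j
      using B by (simp add: less_eq_vec_def)
    have row: "(\<Sum>j\<in>UNIV. B $ i $ j) \<le> (\<Sum>i\<in>UNIV. \<Sum>j\<in>UNIV. B $ i $ j)" for i
      by (rule member_le_sum[where f = "\<lambda>i. \<Sum>j\<in>UNIV. B $ i $ j"]) (auto intro: sum_nonneg B_nonneg)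
    have "0 \<le> (\<Sum>i\<in>UNIV. \<Sum>j\<in>UNIV. B $ i $ j)"
      by (intro sum_nonneg B_nonneg)
    then have "s \<le> t"
      unfolding t_def by linarith
    have one: "0 < ((mat t - B) *v 1) $ i" for i
      unfolding mat_minus_mult_component using row[of i] by (simp add: t_def)
    have "0 \<le> u t"
      by (rule inverse_monotone_if_semipositive[OF B _ one])
        (simp_all add: u_sol[OF \<open>s \<le> t\<close>] less_eq_vec_def)
    then show ?thesis
      using \<open>s \<le> t\<close> by (auto simp: T_def less_eq_vec_def)
  qed
  ultimately have "T = {s..}"
    using connected_clopen[of "{s..}"] by (metis connected_Ici)
  then have "\<And>j. 0 \<le> u s $ j"
    by (auto simp: T_def)
  then show ?thesis
    using u_pos[of s] u_sol[of s] by blast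
qed

section \<open>Inverse monotonicity of nonsingular M-matrices\<close>

lemma M_matrix_inverse_monotone:
  assumes "nonsingular_M_matrix P" and "P *v x \<le> P *v y"
  shows "x \<le> y"
proof -
  obtain s B where B: "0 \<le> B" "spectral_radius B < s" and P: "P = mat s - B"
    using assms(1) by (auto simp: nonsingular_M_matrix_def)
  obtain u where u: "\<And>i. 0 < u $ i" "(mat s - B) *v u = 1"
    using M_matrix_semipositive[OF B] by blast
  have "0 \<le> y - x"
  proof (rule inverse_monotone_if_semipositive[OF B(1) u(1)])
    show "0 \<le> (mat s - B) *v (y - x)"
      using assms(2) by (simp add: P matrix_vector_mult_diff_distrib)
  qed (simp add: u(2))
  then show ?thesis
    by simp
qed

lemma M_matrix_surj:
  assumes "nonsingular_M_matrix P"
  shows "\<exists>x. P *v x = c"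
proof -
  \<comment> \<open>Equal images are comparable both ways, so antisymmetry gives injectivity; in
    finite dimension this yields surjectivity.\<close>
  have "inj ((*v) P)"
    by (rule injI) (metis M_matrix_inverse_monotone[OF assms] order_antisym order_refl)
  then have "surj ((*v) P)"
    using linear_injective_imp_surjective matrix_vector_mul_linear by blast
  then show ?thesis
    by (metis surjD)
qed

section \<open>Tensors and entrywise powers\<close>

lemma vec_power_component [simp]: "vec_power x r $ i = (x $ i) ^ r"
  by (simp add: vec_power_def)

lemma vec_power_mono:
  assumes "0 \<le> x" and "x \<le> y"
  shows "vec_power x r \<le> vec_power y r"
  using assms by (auto simp: less_eq_vec_def intro!: power_mono)

lemma vec_power_le_cancel:
  assumes "0 < r" and "0 \<le> y" and "vec_power x r \<le> vec_power y r"
  shows "x \<le> y"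
  using assms by (metis less_eq_vec_def power_le_imp_le_base vec_power_component zero_index
    Suc_pred)

lemma tendsto_vec_power [tendsto_intros]:
  assumes "(f \<longlongrightarrow> l) F"
  shows "((\<lambda>x. vec_power (f x) r) \<longlongrightarrow> vec_power l r) F"
  by (rule vec_tendstoI) (auto intro!: tendsto_intros assms)

lemma tendsto_tensor_app [tendsto_intros]:
  assumes "(f \<longlongrightarrow> l) F"
  shows "((\<lambda>x. tensor_app m A (f x)) \<longlongrightarrow> tensor_app m A l) F"
proof -
  have "((\<lambda>x. prod_list (map (\<lambda>j. f x $ j) js)) \<longlongrightarrow> prod_list (map (\<lambda>j. l $ j) js)) F" for js
    by (induction js) (auto intro!: tendsto_intros assms)
  then show ?thesis
    unfolding tensor_app_def by (intro vec_tendstoI) (auto intro!: tendsto_intros)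
qed

lemma tensor_app_mono:
  assumes A: "\<And>is. length is = m \<Longrightarrow> 0 \<le> A is" and m: "0 < m" and x: "0 \<le> x" "x \<le> y"
  shows "tensor_app m A x \<le> tensor_app m A y"
proof -
  \<comment> \<open>Nonnegativity is carried through the induction because multiplying the
    inequalities requires it.\<close>
  have "0 \<le> prod_list (map (\<lambda>j. x $ j) js) \<and>
      prod_list (map (\<lambda>j. x $ j) js) \<le> prod_list (map (\<lambda>j. y $ j) js)" for js
    by (induction js) (use x in \<open>auto simp: less_eq_vec_def intro!: mult_mono intro: order_trans\<close>)
  then show ?thesis
    using m by (auto simp: less_eq_vec_def tensor_app_def intro!: sum_mono mult_left_mono A)
qed

text \<open>The remainder is 0 where \<open>MM\<close> keeps the entry, and \<open>- A is\<close>
  elsewhere. All diagonal positions are kept, so the latter entries are off-diagonal and the sign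
  condition applies.\<close>

lemma level1_remainder_nonneg:
  assumes "Z_tensor m A" and "level1_splitting m A MM NN" and m: "0 < m" and len: "length is = m"
  shows "0 \<le> NN is"
proof -
  obtain i js where is_eq: "is = i # js" and js: "length js = m - 1"
    using m len by (cases "is") auto
  have NN: "NN is = MM is - A is"
    using assms(2) len by (simp add: level1_splitting_def)
  have MM: "MM is = (if \<exists>j. js = replicate (m - 1) j then A is else 0)"
    using assms(2) js by (simp add: level1_splitting_def is_eq)
  show ?thesis
  proof (cases "\<exists>j. js = replicate (m - 1) j")
    case True
    then show ?thesis
      using NN MM by simp
  next
    case False
    then have "\<nexists>k. is = replicate m k"
      using m by (cases m) (auto simp: is_eq)
    then have "A is \<le> 0"
      using assms(1) len by (simp add: Z_tensor_def)
    then show ?thesis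
      using NN MM False by simp
  qed
qed

lemma tensor_app_level1_splitting:
  fixes A :: "'n::finite tensor"
  assumes split: "level1_splitting m A MM NN" and m: "2 \<le> m"
  shows "tensor_app m A x =
    majorization_matrix m A *v vec_power x (m - 1) - tensor_app m NN x"
  unfolding vec_eq_iff
proof
  fix i
  let ?L = "{js :: 'n list. length js = m - 1}"
  let ?p = "\<lambda>js. prod_list (map (\<lambda>j. x $ j) js)"
  have fin: "finite ?L"
    using finite_lists_length_eq[of "UNIV :: 'n set" "m - 1"] by simp
  have "(\<Sum>js\<in>?L. MM (i # js) * ?p js) =
      (\<Sum>js\<in>range (replicate (m - 1)). A (i # js) * ?p js)"
    using split by (intro sum.mono_neutral_cong_right fin) (auto simp: level1_splitting_def)
  also have "\<dots> = (\<Sum>j\<in>UNIV. A (i # replicate (m - 1) j) * (x $ j) ^ (m - 1))"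
  proof -
    \<comment> \<open>The exponent \<open>m - 1\<close> is positive, so distinct \<open>j\<close>
      give distinct constant lists and the sum can be reindexed over \<open>j\<close>.\<close>
    have "inj (replicate (m - 1) :: 'n \<Rightarrow> _)"
      using m by (auto intro!: injI simp: replicate_eq_replicate)
    then show ?thesis
      by (simp add: sum.reindex prod_list_replicate)
  qed
  finally have MM: "(\<Sum>js\<in>?L. MM (i # js) * ?p js) =
      (majorization_matrix m A *v vec_power x (m - 1)) $ i"
    by (simp add: matrix_vector_mult_def majorization_matrix_def)
  have "A (i # js) = MM (i # js) - NN (i # js)" if "js \<in> ?L" for js
    using split m that by (simp add: level1_splitting_def)
  then have "tensor_app m A x $ i = (\<Sum>js\<in>?L. MM (i # js) * ?p js - NN (i # js) * ?p js)"
    by (simp add: tensor_app_def left_diff_distrib)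
  then show "tensor_app m A x $ i =
      (majorization_matrix m A *v vec_power x (m - 1) - tensor_app m NN x) $ i"
    unfolding vector_minus_component sum_subtractf MM by (simp add: tensor_app_def)
qed

lemma incseq_vec_bounded_convergent:
  fixes x :: "nat \<Rightarrow> real ^ 'n"
  assumes "\<And>k. x k \<le> x (Suc k)" and "\<And>k. x k \<le> y"
  obtains l where "x \<longlonglongrightarrow> l"
proof -
  have "\<exists>a. (\<lambda>k. x k $ i) \<longlonglongrightarrow> a" for i
  proof -
    have "incseq (\<lambda>k. x k $ i)"
      using assms(1) by (auto intro!: incseq_SucI simp: less_eq_vec_def)
    moreover have "\<forall>k. x k $ i \<le> y $ i"
      using assms(2) by (simp add: less_eq_vec_def)
    ultimately show ?thesis
      using incseq_convergent by metis
  qed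
  then obtain a where "\<And>i. (\<lambda>k. x k $ i) \<longlonglongrightarrow> a i"
    by metis
  then have "x \<longlonglongrightarrow> (\<chi> i. a i)"
    by (intro vec_tendstoI) simp
  then show thesis
    by (rule that)
qed

section \<open>The splitting iteration\<close>

theorem theorem9:
  fixes A MM NN :: "'n::finite tensor"
    and b :: "real ^ 'n"
    and P Q :: "real ^ 'n ^ 'n"
    and m :: nat
  assumes "m \<ge> 2"
    and "Z_tensor m A"
    and "b \<ge> 0"
    and "{x. x \<ge> 0 \<and> tensor_app m A x \<ge> b} \<noteq> {}"
    and "level1_splitting m A MM NN"
    and "majorization_matrix m A = P - Q"
    and "nonsingular_M_matrix P"
    and "Q \<ge> 0"
  shows "(\<exists>!x. splitting_iteration m P Q NN b x) \<and>
    (\<forall>x. splitting_iteration m P Q NN b x \<longrightarrow>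
       (\<forall>k. x k \<le> x (Suc k)) \<and>
       (\<exists>xmin. minimal_nonneg_solution m A b xmin \<and> x \<longlonglongrightarrow> xmin))"
proof -
  have m: "0 < m" "0 < m - 1"
    using assms(1) by auto
  note mono_P = M_matrix_inverse_monotone[OF assms(7)]
  \<comment> \<open>With \<open>R\<close> as the right-hand side of the recursion, \<open>y\<close>
    satisfies \<open>b \<le> tensor_app m A y\<close> exactly when
    \<open>R y \<le> P *v vec_power y (m - 1)\<close>, and solves the equation exactly when equality
    holds.\<close>
  define R where "R x = Q *v vec_power x (m - 1) + tensor_app m NN x + b" for x
  have A_eq: "tensor_app m A x = P *v vec_power x (m - 1) - (R x - b)" for x
    using tensor_app_level1_splitting[OF assms(5,1), of x]
    by (simp add: assms(6) R_def matrix_vector_mult_diff_rdistrib)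
  have R_mono: "R x \<le> R y" if "0 \<le> x" "x \<le> y" for x y
    unfolding R_def using that assms(8) m(1)
    by (intro add_mono order_refl matrix_vector_mult_mono vec_power_mono tensor_app_mono
      level1_remainder_nonneg[OF assms(2,5)]) auto
  have R_nonneg: "0 \<le> R x" if "0 \<le> x" for x
  proof -
    have "tensor_app m NN 0 = 0"
      using m(2) by (auto simp: tensor_app_def vec_eq_iff map_replicate_const intro!: sum.neutral)
    moreover have "vec_power 0 (m - 1) = (0 :: real ^ 'n)"
      using m(2) by (simp add: vec_eq_iff)
    ultimately have "R 0 = b"
      by (simp add: R_def)
    then show ?thesis
      using R_mono[OF order_refl that] assms(3) by simp
  qed
  \<comment> \<open>Comparison principle behind both later inductions: with \<open>y\<close> and
    \<open>y'\<close> consecutive iterates it gives monotonicity, with \<open>y = y'\<close>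
    feasible it gives the upper bound.\<close>
  have step: "x' \<le> y'"
    if "0 \<le> x" "x \<le> y" "0 \<le> y'" "P *v vec_power x' (m - 1) = R x" "R y \<le> P *v vec_power y' (m - 1)"
    for x y x' y'
    by (rule vec_power_le_cancel[OF m(2) that(3)], rule mono_P)
      (use R_mono[OF that(1,2)] that(4,5) in auto)
  \<comment> \<open>Solve the linear system for \<open>w\<close>; inverse monotonicity makes
    \<open>w\<close> nonnegative, so real entrywise roots exist.\<close>
  have step_exists: "\<exists>x'\<ge>0. P *v vec_power x' (m - 1) = R x" if "0 \<le> x" for x
  proof -
    obtain w where w: "P *v w = R x"
      using M_matrix_surj[OF assms(7)] by blast
    have "0 \<le> w"
      by (rule mono_P) (simp add: w R_nonneg[OF that])
    then have "vec_power (\<chi> i. root (m - 1) (w $ i)) (m - 1) = w" "0 \<le> (\<chi> i. root (m - 1) (w $ i))"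
      using m(2) by (auto simp: vec_eq_iff less_eq_vec_def)
    then show ?thesis
      using w by metis
  qed
  have iter: "splitting_iteration m P Q NN b x \<longleftrightarrow>
      x 0 = 0 \<and> (\<forall>k. 0 \<le> x k) \<and> (\<forall>k. P *v vec_power (x (Suc k)) (m - 1) = R (x k))" for x
    by (simp add: splitting_iteration_def R_def)
  have ex: "\<exists>x. splitting_iteration m P Q NN b x"
  proof -
    \<comment> \<open>The starting value is built into the invariant, so dependent choice yields a
      sequence starting at 0.\<close>
    have "\<exists>x. \<forall>k. (0 \<le> x k \<and> (k = 0 \<longrightarrow> x k = 0)) \<and> P *v vec_power (x (Suc k)) (m - 1) = R (x k)"
    proof (rule dependent_nat_choice)
      fix x :: "real ^ 'n" and k :: nat
      assume "0 \<le> x \<and> (k = 0 \<longrightarrow> x = 0)"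
      then show "\<exists>x'. (0 \<le> x' \<and> (Suc k = 0 \<longrightarrow> x' = 0)) \<and> P *v vec_power x' (m - 1) = R x"
        using step_exists[of x] by blast
    qed blast
    then show ?thesis
      unfolding iter by blast
  qed
  have uniq: "x = y" if "splitting_iteration m P Q NN b x" "splitting_iteration m P Q NN b y" for x y
  proof
    fix k
    show "x k = y k"
    proof (induction k)
      case 0
      then show ?case
        using that by (simp add: iter)
    next
      case (Suc k)
      then have eq: "P *v vec_power (x (Suc k)) (m - 1) = P *v vec_power (y (Suc k)) (m - 1)"
        and nonneg: "0 \<le> x (Suc k)" "0 \<le> y (Suc k)"
        using that by (simp_all add: iter)
      show ?case
        using vec_power_le_cancel[OF m(2)] nonneg eq[THEN eq_refl, THEN mono_P]
          eq[symmetric, THEN eq_refl, THEN mono_P]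
        by (intro order_antisym) blast+
    qed
  qed
  have conv: "(\<forall>k. x k \<le> x (Suc k)) \<and>
      (\<exists>xmin. minimal_nonneg_solution m A b xmin \<and> x \<longlonglongrightarrow> xmin)"
    if "splitting_iteration m P Q NN b x" for x
  proof -
    have x0: "x 0 = 0" and x_nonneg: "\<And>k. 0 \<le> x k"
      and x_Suc: "\<And>k. P *v vec_power (x (Suc k)) (m - 1) = R (x k)"
      using that by (auto simp: iter)
    have incr: "x k \<le> x (Suc k)" for k
    proof (induction k)
      case 0
      then show ?case
        using x_nonneg by (simp add: x0)
    next
      case (Suc k)
      show ?case
        by (rule step[OF x_nonneg Suc x_nonneg x_Suc x_Suc[symmetric, THEN eq_refl]])
    qed
    have bound: "x k \<le> y" if y: "0 \<le> y" "b \<le> tensor_app m A y" for y k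
    proof (induction k)
      case 0
      then show ?case
        by (simp add: x0 y(1))
    next
      case (Suc k)
      have "R y \<le> P *v vec_power y (m - 1)"
        using y(2) by (simp add: A_eq less_eq_vec_def)
      then show ?case
        by (rule step[OF x_nonneg Suc y(1) x_Suc])
    qed
    \<comment> \<open>Nonemptiness of the feasible set enters here: any one element bounds the
      increasing iterates, which forces convergence.\<close>
    obtain y where "0 \<le> y" "b \<le> tensor_app m A y"
      using assms(4) by auto
    then obtain l where l: "x \<longlonglongrightarrow> l"
      using incseq_vec_bounded_convergent[of x y] incr bound by blast
    have l_comp: "(\<lambda>k. x k $ i) \<longlonglongrightarrow> l $ i" for i
      using l by (rule tendsto_vec_nth)
    have "0 \<le> l"
      using x_nonneg by (auto simp: less_eq_vec_def intro!: LIMSEQ_le_const[OF l_comp])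
    moreover have "tensor_app m A l = b"
    proof -
      have lin: "(\<lambda>k. S *v f k) \<longlonglongrightarrow> S *v v" if "f \<longlonglongrightarrow> v" for S :: "real ^ 'n ^ 'n" and f v
        using that by (rule bounded_linear.tendsto[OF matrix_vector_mul_bounded_linear])
      \<comment> \<open>Both sides of the recursion are continuous, so the limit satisfies the
        fixed-point equation, equivalent to the tensor equation by \<open>A_eq\<close>.\<close>
      have "(\<lambda>k. P *v vec_power (x (Suc k)) (m - 1)) \<longlonglongrightarrow> P *v vec_power l (m - 1)"
        by (intro lin tendsto_intros LIMSEQ_Suc l)
      moreover have "(\<lambda>k. R (x k)) \<longlonglongrightarrow> R l"
        unfolding R_def by (intro lin tendsto_intros l)
      ultimately have "P *v vec_power l (m - 1) = R l"
        unfolding x_Suc by (rule LIMSEQ_unique)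
      then show ?thesis
        by (simp add: A_eq)
    qed
    \<comment> \<open>A nonnegative solution is feasible, so \<open>bound\<close> applies to it and
      passes to the limit.\<close>
    moreover have "l \<le> y" if "0 \<le> y" "tensor_app m A y = b" for y
      using bound[of y] that by (auto simp: less_eq_vec_def intro!: LIMSEQ_le_const2[OF l_comp])
    ultimately show ?thesis
      using incr l by (auto simp: minimal_nonneg_solution_def)
  qed
  show ?thesis
    using ex uniq conv by blast
qed

end
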